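(* Let $B=\{(0,0),(0,1),(0,2),(3,0)\}$ and define $S_1=\{(1,1),(1,2),(1,3),(2,2),(3,2)\}$, $S_2=\{(1,2),(2,2),(3,1),(3,2),(3,3)\}$, $S_3=\{(1,1),(1,3),(2,1),(2,2),(2,3)\}$, $S_4=\{(2,1),(2,2),(2,3),(3,1),(3,3)\}$, $S_5=\{(1,1),(1,3),(2,1),(2,3)\}$, $S_6=\{(2,1),(2,3),(3,1),(3,3)\}$, $S_7=\{(1,1),(1,2),(1,3),(3,2)\}$, $S_8=\{(1,2),(3,1),(3,2),(3,3)\}$. For $1\le j\le 8$ let $X_j=B\cup S_j$ and $Y_j=\{(y,x):(x,y)\in X_j\}$. Then for every $j\in\{1,\dots,8\}$, $(123,X_j)\sim_{jd}(132,X_j)$ and $(123,Y_j)\sim_{jd}(132,Y_j)$.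
   Context: $S_n$ is the set of permutations $\pi=\pi_1\cdots\pi_n$ of $\{1,\dots,n\}$. A mesh pattern of length $k$ is a pair $(\tau,R)$ with $\tau\in S_k$ and $R\subseteq\{0,\dots,k\}\times\{0,\dots,k\}$ (the set of shaded boxes; box $(a,b)$ is the unit square with lower-left corner $(a,b)$). An occurrence of $(\tau,R)$ in $\pi\in S_n$ is a subsequence $\pi_{i_1}\cdots\pi_{i_k}$, $i_1<\dots<i_k$, order-isomorphic to $\tau$, such that, with $i_0=0$, $i_{k+1}=n+1$, with $v_1<\dots<v_k$ the values $\pi_{i_1},\dots,\pi_{i_k}$ in increasing order, and $v_0=0$, $v_{k+1}=n+1$, for each $(a,b)\in R$ there is no index $m$ with $i_a<m<i_{a+1}$ and $v_b<\pi_m<v_{b+1}$. Two mesh patterns $q_1,q_2$ are jointly equidistributed, written $q_1\sim_{jd}q_2$, if for all nonnegative integers $n,k,\ell$ the number of $\pi\in S_n$ with exactly $k$ occurrences of $q_1$ and $\ell$ occurrences of $q_2$ equals the number of $\pi\in S_n$ with exactly $\ell$ occurrences of $q_1$ and $k$ occurrences of $q_2$. *)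

theory Defs
  imports "HOL-Combinatorics.Combinatorics"
begin

text \<open>Permutations are lists in one-line notation. Positions and values both start at 1,
  so \<open>at1 xs m\<close> is the m-th entry (junk for \<open>m = 0\<close> or \<open>m > length xs\<close>).\<close>

definition perms :: "nat \<Rightarrow> nat list set" where
  "perms n = permutations_of_set {1..n}"

abbreviation at1 :: "'a list \<Rightarrow> nat \<Rightarrow> 'a" where
  "at1 xs m \<equiv> xs ! (m - 1)"

type_synonym mesh = "nat list \<times> (nat \<times> nat) set"

definition is_mesh_pattern :: "mesh \<Rightarrow> bool" where
  "is_mesh_pattern q \<longleftrightarrow> (case q of (\<tau>, R) \<Rightarrow>
     \<tau> \<in> perms (length \<tau>) \<and> R \<subseteq> {0..length \<tau>} \<times> {0..length \<tau>})"

definition order_isomorphic :: "nat list \<Rightarrow> nat list \<Rightarrow> bool" where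
  "order_isomorphic xs ys \<longleftrightarrow> length xs = length ys \<and>
     (\<forall>i < length xs. \<forall>j < length xs. xs ! i < xs ! j \<longleftrightarrow> ys ! i < ys ! j)"

text \<open>An occurrence in a permutation of length n is recorded by its list of positions
  \<open>[i\<^sub>1, \<dots>, i\<^sub>k]\<close>. Adding the sentinels 0 and n + 1 with \<open>framed\<close> makes \<open>framed n xs ! a\<close>
  equal to \<open>i\<^sub>a\<close> (or \<open>v\<^sub>a\<close>) for \<open>0 \<le> a \<le> k + 1\<close>.\<close>

definition framed :: "nat \<Rightarrow> nat list \<Rightarrow> nat list" where
  "framed n xs = 0 # xs @ [n + 1]"

definition occurrences :: "mesh \<Rightarrow> nat list \<Rightarrow> nat list set" where
  "occurrences q \<pi> = (case q of (\<tau>, R) \<Rightarrow>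
     {is. sorted_wrt (<) is \<and> set is \<subseteq> {1..length \<pi>} \<and>
          order_isomorphic (map (at1 \<pi>) is) \<tau> \<and>
          (let i = framed (length \<pi>) is;
               v = framed (length \<pi>) (sort (map (at1 \<pi>) is))
           in \<forall>(a, b) \<in> R. \<not> (\<exists>m. i ! a < m \<and> m < i ! (a + 1) \<and>
                                   v ! b < at1 \<pi> m \<and> at1 \<pi> m < v ! (b + 1)))})"

definition jointly_equidistributed :: "mesh \<Rightarrow> mesh \<Rightarrow> bool" (infix "\<sim>jd" 50) where
  "q1 \<sim>jd q2 \<longleftrightarrow> is_mesh_pattern q1 \<and> is_mesh_pattern q2 \<and>
     (\<forall>n k l.
        card {\<pi> \<in> perms n. card (occurrences q1 \<pi>) = k \<and> card (occurrences q2 \<pi>) = l} =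
        card {\<pi> \<in> perms n. card (occurrences q1 \<pi>) = l \<and> card (occurrences q2 \<pi>) = k})"

definition B :: "(nat \<times> nat) set" where
  "B = {(0,0), (0,1), (0,2), (3,0)}"

definition S :: "nat \<Rightarrow> (nat \<times> nat) set" where
  "S j = at1
    [{(1,1), (1,2), (1,3), (2,2), (3,2)},
     {(1,2), (2,2), (3,1), (3,2), (3,3)},
     {(1,1), (1,3), (2,1), (2,2), (2,3)},
     {(2,1), (2,2), (2,3), (3,1), (3,3)},
     {(1,1), (1,3), (2,1), (2,3)},
     {(2,1), (2,3), (3,1), (3,3)},
     {(1,1), (1,2), (1,3), (3,2)},
     {(1,2), (3,1), (3,2), (3,3)}] j"

definition X :: "nat \<Rightarrow> (nat \<times> nat) set" where
  "X j = B \<union> S j"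

definition Y :: "nat \<Rightarrow> (nat \<times> nat) set" where
  "Y j = {(y, x) |x y. (x, y) \<in> X j}"

end

theory Submission
  imports Defs
begin

text \<open>Cut the values of a permutation into bands at its left-to-right minima, fix these minima
  and reverse the values inside each band. This is an involution. The boxes (0,0), (0,1), (0,2)
  force the first letter of an occurrence of 123 or 132 to be a left-to-right minimum and the other
  two letters to lie in the band directly above it. Hence the involution exchanges the two patterns
  at the same three positions, as soon as rows 1 and 3 of the shading agree to the right of
  column 0. The transposed shadings follow by passing to inverse permutations.\<close>

section \<open>Reversing the values between consecutive elements of a set\<close>

text \<open>The sentinel 0, like \<open>n + 1\<close> in \<open>band_ceiling\<close>, closes the
  outermost band, so the extremum is always taken over a nonempty set.\<close>

definition band_floor :: "nat set \<Rightarrow> nat \<Rightarrow> nat" where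
  "band_floor L x = Max (insert 0 {l \<in> L. l \<le> x})"

definition band_ceiling :: "nat \<Rightarrow> nat set \<Rightarrow> nat \<Rightarrow> nat" where
  "band_ceiling n L x = Min (insert (n + 1) {l \<in> L. x < l})"

text \<open>Inside a band with ends a and c this is the reflection sending x to a + c - x. The
  subtraction on naturals is not truncated there, because x < c.\<close>

definition band_flip :: "nat \<Rightarrow> nat set \<Rightarrow> nat \<Rightarrow> nat" where
  "band_flip n L x = (if x \<in> L then x else band_floor L x + band_ceiling n L x - x)"

text \<open>With no element of \<open>L\<close> strictly between \<open>a\<close> and
  \<open>c\<close>, these are the maximum and the minimum in the definition. Together with
  \<open>band_exists\<close> this reduces every claim about the flip to linear arithmetic in a + c -
  x.\<close>

lemma band_flip_eq:
  assumes "finite L" "a \<in> insert 0 L" "c \<in> insert (n + 1) L" "c \<le> n + 1"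
    and "\<And>l. l \<in> L \<Longrightarrow> l \<le> a \<or> c \<le> l" and "a < x" "x < c"
  shows "band_flip n L x = a + c - x"
proof -
  have "band_floor L x = a"
    unfolding band_floor_def using assms by (intro Max_eqI) force+
  moreover have "band_ceiling n L x = c"
    unfolding band_ceiling_def using assms by (intro Min_eqI) force+
  moreover have "x \<notin> L"
    using assms(5-7) by force
  ultimately show ?thesis
    by (simp add: band_flip_def)
qed

lemma band_flip_fixed: "x \<in> L \<Longrightarrow> band_flip n L x = x"
  by (simp add: band_flip_def)

lemma band_exists:
  fixes L :: "nat set"
  assumes "L \<subseteq> {1..n}" "x \<in> {1..n}" "x \<notin> L"
  obtains a c where "a \<in> insert 0 L" "c \<in> insert (n + 1) L" "c \<le> n + 1" "a < x" "x < c"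
    "\<And>l. l \<in> L \<Longrightarrow> l \<le> a \<or> c \<le> l"
proof -
  have fin: "finite L"
    using assms(1) by (rule finite_subset) simp
  let ?A = "insert 0 {l \<in> L. l \<le> x}" and ?C = "insert (n + 1) {l \<in> L. x < l}"
  have finA: "finite ?A" and finC: "finite ?C"
    using fin by auto
  have A: "Max ?A \<in> ?A" and C: "Min ?C \<in> ?C"
    by (rule Max_in[OF finA], simp) (rule Min_in[OF finC], simp)
  have sep: "l \<le> Max ?A \<or> Min ?C \<le> l" if "l \<in> L" for l
  proof (cases "l \<le> x")
    case True
    then show ?thesis using that Max_ge[OF finA, of l] by simp
  next
    case False
    then show ?thesis using that Min_le[OF finC, of l] by simp
  qed
  have "Max ?A \<in> insert 0 L" "Min ?C \<in> insert (n + 1) L"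
    using A C by auto
  moreover have "\<forall>y \<in> ?A. y < x"
    using assms(2,3) by (auto simp: order.order_iff_strict)
  then have "Max ?A < x"
    using A by blast
  moreover have "\<forall>y \<in> ?C. x < y \<and> y \<le> n + 1"
    using assms(1,2) by auto
  then have "x < Min ?C" "Min ?C \<le> n + 1"
    using C by blast+
  ultimately show thesis
    using that sep by blast
qed

lemma band_flip_in_range:
  assumes "L \<subseteq> {1..n}" "x \<in> {1..n}"
  shows "band_flip n L x \<in> {1..n}"
proof (cases "x \<in> L")
  case False
  have "finite L"
    using assms(1) by (rule finite_subset) simp
  then obtain a c where ac: "a \<in> insert 0 L" "c \<in> insert (n + 1) L" "c \<le> n + 1" "a < x" "x < c"
    "\<And>l. l \<in> L \<Longrightarrow> l \<le> a \<or> c \<le> l"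
    using band_exists[OF assms False] by blast
  then have "band_flip n L x = a + c - x"
    using band_flip_eq[OF \<open>finite L\<close> ac(1-3,6,4,5)] by blast
  then show ?thesis
    using ac(3-5) by auto
qed (use assms in \<open>simp add: band_flip_fixed\<close>)

text \<open>The reflection keeps a value in its band, and reflecting twice at the same two ends
  gives the identity.\<close>

lemma band_flip_band_flip:
  assumes "L \<subseteq> {1..n}" "x \<in> {1..n}"
  shows "band_flip n L (band_flip n L x) = x"
proof (cases "x \<in> L")
  case False
  have fin: "finite L"
    using assms(1) by (rule finite_subset) simp
  obtain a c where ac: "a \<in> insert 0 L" "c \<in> insert (n + 1) L" "c \<le> n + 1" "a < x" "x < c"
    "\<And>l. l \<in> L \<Longrightarrow> l \<le> a \<or> c \<le> l"
    using band_exists[OF assms False] by blast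
  have "band_flip n L x = a + c - x"
    using band_flip_eq[OF fin ac(1-3,6,4,5)] by blast
  \<comment> \<open>The image is again strictly between \<open>a\<close> and \<open>c\<close>, so
    the same two ends serve for the second flip.\<close>
  moreover have "band_flip n L (a + c - x) = a + c - (a + c - x)"
    by (rule band_flip_eq[OF fin ac(1-3,6)]) (use ac in auto)
  ultimately show ?thesis
    using ac by simp
qed (simp add: band_flip_fixed)

text \<open>An element of \<open>L\<close> is at most \<open>a\<close> or at least \<open>c\<close>,
  while \<open>x\<close> and its image both lie strictly between. So only comparisons inside one
  band can change.\<close>

lemma band_flip_compare:
  assumes "L \<subseteq> {1..n}" "x \<in> {1..n}" "l \<in> L"
  shows "l < band_flip n L x \<longleftrightarrow> l < x" and "band_flip n L x < l \<longleftrightarrow> x < l"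
proof -
  have "(l < band_flip n L x \<longleftrightarrow> l < x) \<and> (band_flip n L x < l \<longleftrightarrow> x < l)"
  proof (cases "x \<in> L")
    case False
    have fin: "finite L"
      using assms(1) by (rule finite_subset) simp
    obtain a c where ac: "a \<in> insert 0 L" "c \<in> insert (n + 1) L" "c \<le> n + 1" "a < x" "x < c"
      "\<And>l. l \<in> L \<Longrightarrow> l \<le> a \<or> c \<le> l"
      using band_exists[OF assms(1,2) False] by blast
    have "band_flip n L x = a + c - x"
      using band_flip_eq[OF fin ac(1-3,6,4,5)] by blast
    then show ?thesis
      using ac(4,5) ac(6)[OF assms(3)] by auto
  qed (simp add: band_flip_fixed)
  then show "l < band_flip n L x \<longleftrightarrow> l < x" and "band_flip n L x < l \<longleftrightarrow> x < l"
    by blast+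
qed

section \<open>The involution\<close>

text \<open>Distinctness comes from counting: n entries that cover n values cannot repeat.\<close>

lemma perms_iff: "\<pi> \<in> perms n \<longleftrightarrow> length \<pi> = n \<and> set \<pi> = {1..n}"
  by (auto simp: perms_def permutations_of_set_def distinct_card
      intro: card_distinct dest: distinct_card[symmetric])

lemma perms_distinct: "\<pi> \<in> perms n \<Longrightarrow> distinct \<pi>"
  by (simp add: perms_def permutations_of_set_def)

lemma at1_perm_in:
  assumes "\<pi> \<in> perms n" "1 \<le> m" "m \<le> n"
  shows "at1 \<pi> m \<in> {1..n}"
proof -
  have "at1 \<pi> m \<in> set \<pi>"
    using assms by (intro nth_mem) (auto simp: perms_iff)
  then show ?thesis
    using assms(1) by (simp add: perms_iff)
qed

lemma at1_perm_inj:
  assumes "\<pi> \<in> perms n" "1 \<le> m" "m \<le> n" "1 \<le> m'" "m' \<le> n" "at1 \<pi> m = at1 \<pi> m'"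
  shows "m = m'"
proof -
  have "m - 1 = m' - 1"
    using assms perms_distinct[OF assms(1)] by (auto simp: perms_iff nth_eq_iff_index_eq)
  then show ?thesis
    using assms(2,4) by linarith
qed

section \<open>Left-to-right minima and the flip of a permutation\<close>

definition is_lr_min :: "nat list \<Rightarrow> nat \<Rightarrow> bool" where
  "is_lr_min \<pi> k \<longleftrightarrow> k < length \<pi> \<and> (\<forall>j<k. \<pi> ! k < \<pi> ! j)"

text \<open>Values are collected rather than positions, since they are what cuts the value axis into
  bands.\<close>

definition lr_minima :: "nat list \<Rightarrow> nat set" where
  "lr_minima \<pi> = {\<pi> ! k |k. is_lr_min \<pi> k}"

definition flip_bands :: "nat list \<Rightarrow> nat list" where
  "flip_bands \<pi> = map (band_flip (length \<pi>) (lr_minima \<pi>)) \<pi>"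

lemma lr_minima_subset: "\<pi> \<in> perms n \<Longrightarrow> lr_minima \<pi> \<subseteq> {1..n}"
  by (force simp: lr_minima_def is_lr_min_def perms_iff)

text \<open>An entry that is not a minimum has an earlier entry not above it, strictly smaller by
  distinctness. Either that one is a minimum or the descent continues from it.\<close>

lemma exists_lr_min_before:
  assumes "distinct \<pi>" "k < length \<pi>" "\<not> is_lr_min \<pi> k"
  shows "\<exists>j<k. is_lr_min \<pi> j \<and> \<pi> ! j < \<pi> ! k"
  using assms(2,3)
proof (induction k rule: less_induct)
  case (less k)
  then obtain j where j: "j < k" "\<pi> ! j \<le> \<pi> ! k"
    unfolding is_lr_min_def by (meson not_le)
  then have "\<pi> ! j < \<pi> ! k"
    using assms(1) less.prems by (metis nth_eq_iff_index_eq le_neq_implies_less order.strict_trans less_irrefl)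
  then show ?case
    using less j by (metis order.strict_trans)
qed

lemma flip_bands_perm:
  assumes "\<pi> \<in> perms n"
  shows "flip_bands \<pi> \<in> perms n"
proof -
  let ?f = "band_flip n (lr_minima \<pi>)"
  have L: "lr_minima \<pi> \<subseteq> {1..n}"
    using assms by (rule lr_minima_subset)
  have "?f ` {1..n} = {1..n}"
  proof
    show "?f ` {1..n} \<subseteq> {1..n}"
      using band_flip_in_range[OF L] by blast
    show "{1..n} \<subseteq> ?f ` {1..n}"
    proof
      fix x assume "x \<in> {1..n}"
      then show "x \<in> ?f ` {1..n}"
        using band_flip_band_flip[OF L] band_flip_in_range[OF L] by (metis imageI)
    qed
  qed
  then show ?thesis
    using assms by (simp add: perms_iff flip_bands_def)
qed

lemma nth_flip_bands:
  "k < length \<pi> \<Longrightarrow> flip_bands \<pi> ! k = band_flip (length \<pi>) (lr_minima \<pi>) (\<pi> ! k)"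
  by (simp add: flip_bands_def)

text \<open>Minima are fixed and comparisons with them are preserved, so a minimum stays one.
  Conversely, an entry that is not a minimum has an earlier minimum below it, and this remains below
  it after the flip.\<close>

lemma is_lr_min_flip_bands:
  assumes "\<pi> \<in> perms n"
  shows "is_lr_min (flip_bands \<pi>) k \<longleftrightarrow> is_lr_min \<pi> k"
proof -
  have L: "lr_minima \<pi> \<subseteq> {1..n}" and len: "length \<pi> = n" "length (flip_bands \<pi>) = n"
    using assms lr_minima_subset flip_bands_perm by (auto simp: perms_iff)
  have range: "\<pi> ! j \<in> {1..n}" if "j < n" for j
    using that assms nth_mem[of j \<pi>] by (simp add: perms_iff)
  show ?thesis
  proof
    assume k: "is_lr_min \<pi> k"
    then have "\<pi> ! k \<in> lr_minima \<pi>" "k < n"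
      by (auto simp: lr_minima_def is_lr_min_def len)
    then show "is_lr_min (flip_bands \<pi>) k"
      using k len range by (auto simp: is_lr_min_def nth_flip_bands band_flip_fixed band_flip_compare(1)[OF L])
  next
    assume k: "is_lr_min (flip_bands \<pi>) k"
    then have kn: "k < n"
      by (simp add: is_lr_min_def len)
    show "is_lr_min \<pi> k"
    proof (rule ccontr)
      assume "\<not> is_lr_min \<pi> k"
      then obtain j where j: "j < k" "is_lr_min \<pi> j" "\<pi> ! j < \<pi> ! k"
        using exists_lr_min_before perms_distinct[OF assms] kn len by metis
      then have "\<pi> ! j \<in> lr_minima \<pi>"
        by (auto simp: lr_minima_def)
      then have "flip_bands \<pi> ! j < flip_bands \<pi> ! k"
        using j kn range len by (simp add: nth_flip_bands band_flip_fixed band_flip_compare(1)[OF L])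
      then show False
        using k j(1) by (auto simp: is_lr_min_def)
    qed
  qed
qed

lemma lr_minima_flip_bands:
  assumes "\<pi> \<in> perms n"
  shows "lr_minima (flip_bands \<pi>) = lr_minima \<pi>"
proof -
  have "flip_bands \<pi> ! k = \<pi> ! k" if "is_lr_min \<pi> k" for k
    using that by (auto simp: nth_flip_bands is_lr_min_def lr_minima_def intro!: band_flip_fixed)
  then show ?thesis
    unfolding lr_minima_def is_lr_min_flip_bands[OF assms] by force
qed

text \<open>The second flip uses the same set of minima as the first, so the claim reduces to the
  involution on single values.\<close>

lemma flip_bands_flip_bands:
  assumes "\<pi> \<in> perms n"
  shows "flip_bands (flip_bands \<pi>) = \<pi>"
proof -
  have len: "length (flip_bands \<pi>) = length \<pi>" "length \<pi> = n"
    using assms by (auto simp: perms_iff flip_bands_def)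
  have "flip_bands (flip_bands \<pi>) = map (band_flip n (lr_minima \<pi>)) (flip_bands \<pi>)"
    by (subst (1) flip_bands_def) (simp only: len lr_minima_flip_bands[OF assms])
  also have "\<dots> = \<pi>"
    using band_flip_band_flip[OF lr_minima_subset[OF assms]] assms
    by (auto simp: flip_bands_def perms_iff intro!: map_idI)
  finally show ?thesis .
qed

section \<open>Occurrences of 123 and 132\<close>

text \<open>Positions and values are two separate framed lists. This allows the value list to be
  changed alone under the flip, and the two lists to trade places under inversion.\<close>

definition empty_boxes :: "(nat \<times> nat) set \<Rightarrow> nat list \<Rightarrow> nat list \<Rightarrow> nat list \<Rightarrow> bool" where
  "empty_boxes R \<pi> is vs \<longleftrightarrow> (\<forall>(a, b) \<in> R. \<not> (\<exists>m. is ! a < m \<and> m < is ! (a + 1) \<and>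
     vs ! b < at1 \<pi> m \<and> at1 \<pi> m < vs ! (b + 1)))"

lemma order_isomorphic_123:
  "order_isomorphic [x, y, z] [1, 2, 3] \<longleftrightarrow> x < y \<and> y < z"
  by (auto simp: order_isomorphic_def less_Suc_eq numeral_3_eq_3 All_less_Suc)

lemma order_isomorphic_132:
  "order_isomorphic [x, y, z] [1, 3, 2] \<longleftrightarrow> x < z \<and> z < y"
  by (auto simp: order_isomorphic_def less_Suc_eq numeral_3_eq_3 All_less_Suc)

lemma occurrences_length_3_iff:
  assumes "length \<pi> = n" "length \<tau> = 3"
  shows "is \<in> occurrences (\<tau>, R) \<pi> \<longleftrightarrow> (\<exists>i j k. is = [i, j, k] \<and>
    1 \<le> i \<and> i < j \<and> j < k \<and> k \<le> n \<and> order_isomorphic [at1 \<pi> i, at1 \<pi> j, at1 \<pi> k] \<tau> \<and>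
    empty_boxes R \<pi> [0, i, j, k, n + 1] (0 # sort [at1 \<pi> i, at1 \<pi> j, at1 \<pi> k] @ [n + 1]))"
proof -
  have iff: "[i, j, k] \<in> occurrences (\<tau>, R) \<pi> \<longleftrightarrow>
      1 \<le> i \<and> i < j \<and> j < k \<and> k \<le> n \<and> order_isomorphic [at1 \<pi> i, at1 \<pi> j, at1 \<pi> k] \<tau> \<and>
      empty_boxes R \<pi> [0, i, j, k, n + 1] (0 # sort [at1 \<pi> i, at1 \<pi> j, at1 \<pi> k] @ [n + 1])"
    for i j k
  proof -
    have "sorted_wrt (<) [i, j, k] \<and> set [i, j, k] \<subseteq> {1..n} \<longleftrightarrow> 1 \<le> i \<and> i < j \<and> j < k \<and> k \<le> n"
      by auto
    then show ?thesis
      by (simp only: occurrences_def empty_boxes_def framed_def Let_def prod.case mem_Collect_eq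
          list.map append.simps assms(1)) blast
  qed
  have "length is = 3" if "is \<in> occurrences (\<tau>, R) \<pi>"
    using that assms(2) by (simp add: occurrences_def order_isomorphic_def)
  then have "\<exists>i j k. is = [i, j, k]" if "is \<in> occurrences (\<tau>, R) \<pi>"
    using that by (auto simp: numeral_3_eq_3 length_Suc_conv)
  then show ?thesis
    using iff by blast
qed

lemma occurrences_123_iff:
  assumes "length \<pi> = n"
  shows "is \<in> occurrences ([1,2,3], R) \<pi> \<longleftrightarrow> (\<exists>i j k. is = [i, j, k] \<and>
    1 \<le> i \<and> i < j \<and> j < k \<and> k \<le> n \<and> at1 \<pi> i < at1 \<pi> j \<and> at1 \<pi> j < at1 \<pi> k \<and>
    empty_boxes R \<pi> [0, i, j, k, n + 1] [0, at1 \<pi> i, at1 \<pi> j, at1 \<pi> k, n + 1])"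
proof -
  have len: "length [1, 2, 3 :: nat] = 3"
    by simp
  have sort: "0 # sort [x, y, z] @ [n + 1] = [0, x, y, z, n + 1]" if "x < y" "y < z" for x y z
    using that by auto
  show ?thesis
    unfolding occurrences_length_3_iff[OF assms len] order_isomorphic_123
    by (intro ex_cong1) (metis sort)
qed

text \<open>The middle value of 132 sits at the last position, so \<open>k\<close> precedes
  \<open>j\<close> in the sorted value list.\<close>

lemma occurrences_132_iff:
  assumes "length \<pi> = n"
  shows "is \<in> occurrences ([1,3,2], R) \<pi> \<longleftrightarrow> (\<exists>i j k. is = [i, j, k] \<and>
    1 \<le> i \<and> i < j \<and> j < k \<and> k \<le> n \<and> at1 \<pi> i < at1 \<pi> k \<and> at1 \<pi> k < at1 \<pi> j \<and>
    empty_boxes R \<pi> [0, i, j, k, n + 1] [0, at1 \<pi> i, at1 \<pi> k, at1 \<pi> j, n + 1])"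
proof -
  have len: "length [1, 3, 2 :: nat] = 3"
    by simp
  have sort: "0 # sort [x, y, z] @ [n + 1] = [0, x, z, y, n + 1]" if "x < z" "z < y" for x y z
    using that by auto
  show ?thesis
    unfolding occurrences_length_3_iff[OF assms len] order_isomorphic_132
    by (intro ex_cong1) (metis sort)
qed

lemma finite_occurrences: "finite (occurrences q \<pi>)"
proof -
  have "occurrences q \<pi> \<subseteq> {is. distinct is \<and> set is \<subseteq> {1..length \<pi>}}"
    by (auto simp: occurrences_def strict_sorted_iff split: prod.splits)
  then show ?thesis
    using finite_subset_distinct[of "{1..length \<pi>}"] finite_subset by (metis (no_types, lifting) Collect_cong conj_commute finite_atLeastAtMost)
qed

text \<open>Here \<open>u\<close> and \<open>v\<close> are the middle and top values of an
  occurrence of either pattern; the set equation in the hypotheses covers both orders. Reversing the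
  band keeps rows 0 and 2, exchanges row 1 with the part of row 3 inside the band, and keeps the
  part of row 3 above the band. Agreement of rows 1 and 3 therefore preserves emptiness in columns 1
  to 3; column 0 is treated apart.\<close>

lemma empty_boxes_flip_bands:
  assumes \<pi>: "\<pi> \<in> perms n"
    and R: "R \<subseteq> {0..3} \<times> {0..3}" "(0,0) \<in> R" "(0,1) \<in> R" "(0,2) \<in> R"
      "\<And>x. x \<in> {1..3} \<Longrightarrow> (x,1) \<in> R \<longleftrightarrow> (x,3) \<in> R"
    and pos: "1 \<le> i" "i < j" "j < k" "k \<le> n"
    and vals: "at1 \<pi> i < u" "u < v" "{u, v} = {at1 \<pi> j, at1 \<pi> k}"
    and empty: "empty_boxes R \<pi> [0, i, j, k, n + 1] [0, at1 \<pi> i, u, v, n + 1]"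
  defines "f \<equiv> band_flip n (lr_minima \<pi>)"
  shows "f (at1 \<pi> i) = at1 \<pi> i" and "at1 \<pi> i < f v" and "f v < f u"
    and "empty_boxes R (flip_bands \<pi>) [0, i, j, k, n + 1] [0, at1 \<pi> i, f v, f u, n + 1]"
proof -
  let ?a = "at1 \<pi> i" and ?L = "lr_minima \<pi>"
  \<comment> \<open>The upper end of the band directly above the first letter: the next larger
    left-to-right minimum, or \<open>n + 1\<close> if there is none.\<close>
  define c where "c = Min (insert (n + 1) {l \<in> ?L. ?a < l})"
  have L: "?L \<subseteq> {1..n}" and fin: "finite ?L" and len: "length \<pi> = n"
    using lr_minima_subset[OF \<pi>] finite_subset \<pi> by (auto simp: perms_iff)
  have range: "at1 \<pi> m \<in> {1..n}" if "1 \<le> m" "m \<le> n" for m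
    using that at1_perm_in[OF \<pi>] by blast
  have uv: "u \<in> {1..n}" "v \<in> {1..n}"
    using vals(3) pos range[of j] range[of k] by (auto simp: doubleton_eq_iff)
  have box: "\<not> (\<exists>m. [0, i, j, k, n + 1] ! x < m \<and> m < [0, i, j, k, n + 1] ! (x + 1) \<and>
      [0, ?a, u, v, n + 1] ! y < at1 \<pi> m \<and> at1 \<pi> m < [0, ?a, u, v, n + 1] ! (y + 1))"
    if "(x, y) \<in> R" for x y
    using empty that by (force simp: empty_boxes_def)
  \<comment> \<open>The boxes (0,0), (0,1) and (0,2) exclude all smaller values left of
    \<open>i\<close>, and injectivity excludes the three letters themselves.\<close>
  have before: "v < at1 \<pi> m" if "1 \<le> m" "m < i" for m
  proof -
    have "at1 \<pi> m \<noteq> at1 \<pi> p" if "i \<le> p" "p \<le> n" for p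
      using at1_perm_inj[OF \<pi>, of m p] that \<open>1 \<le> m\<close> \<open>m < i\<close> by auto
    from this[of i] this[of j] this[of k] have ne: "at1 \<pi> m \<noteq> ?a" "at1 \<pi> m \<noteq> u" "at1 \<pi> m \<noteq> v"
      using vals(3) pos by (auto simp: doubleton_eq_iff)
    have "\<not> (0 < at1 \<pi> m \<and> at1 \<pi> m < ?a)"
      using box[OF R(2)] that by auto
    moreover have "\<not> (?a < at1 \<pi> m \<and> at1 \<pi> m < u)"
      using box[OF R(3)] that by auto
    moreover have "\<not> (u < at1 \<pi> m \<and> at1 \<pi> m < v)"
      using box[OF R(4)] that by (auto simp: numeral_2_eq_2)
    moreover have "0 < at1 \<pi> m"
      using range[of m] that pos by simp
    ultimately show ?thesis
      using ne by linarith
  qed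
  \<comment> \<open>\<open>is_lr_min\<close> counts indices from 0, positions count from 1.\<close>
  have a_min: "is_lr_min \<pi> (i - 1)"
    unfolding is_lr_min_def
  proof (intro conjI allI impI)
    show "i - 1 < length \<pi>"
      using pos len by auto
    fix p assume "p < i - 1"
    then have "v < \<pi> ! p"
      using before[of "p + 1"] by auto
    then show "\<pi> ! (i - 1) < \<pi> ! p"
      using vals(1,2) by linarith
  qed
  then have aL: "?a \<in> ?L"
    by (auto simp: lr_minima_def)
  \<comment> \<open>Left-to-right minima decrease, so one larger than the first letter stands left
    of \<open>i\<close> and hence exceeds \<open>v\<close>. Thus \<open>u\<close> and
    \<open>v\<close> lie below \<open>c\<close>, in the band.\<close>
  have above: "v < l" if "l \<in> ?L" "?a < l" for l
  proof -
    obtain p where p: "l = \<pi> ! p" "is_lr_min \<pi> p"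
      using \<open>l \<in> ?L\<close> by (auto simp: lr_minima_def)
    have "p < i - 1"
      using p \<open>?a < l\<close> by (metis is_lr_min_def not_less_iff_gr_or_eq)
    then show ?thesis
      using before[of "p + 1"] p by auto
  qed
  have c: "c \<in> insert (n + 1) {l \<in> ?L. ?a < l}"
    unfolding c_def using fin by (intro Min_in) auto
  then have c': "c \<in> insert (n + 1) ?L" "c \<le> n + 1" "v < c"
    using above uv L by auto
  have sep: "l \<le> ?a \<or> c \<le> l" if "l \<in> ?L" for l
    using that fin unfolding c_def by (cases "l \<le> ?a") (auto intro!: Min_le)
  have f_band: "f x = ?a + c - x" if "?a < x" "x < c" for x
    unfolding f_def using band_flip_eq[OF fin _ c'(1,2) sep] that aL by blast
  have f_below: "f x < ?a \<longleftrightarrow> x < ?a" "?a < f x \<longleftrightarrow> ?a < x" if "x \<in> {1..n}" for x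
    unfolding f_def using band_flip_compare[OF L that aL] by auto
  \<comment> \<open>If \<open>c\<close> is the sentinel \<open>n + 1\<close>, both sides are false
    because values do not exceed \<open>n\<close>.\<close>
  have f_above: "c \<le> f x \<longleftrightarrow> c \<le> x" if "x \<in> {1..n}" for x
  proof (cases "c \<in> ?L")
    case True
    then show ?thesis
      unfolding f_def using band_flip_compare[OF L that True] by (simp add: not_less[symmetric])
  next
    case False
    then have "c = n + 1"
      using c'(1) by simp
    moreover have "f x \<in> {1..n}"
      unfolding f_def using band_flip_in_range[OF L that] .
    ultimately show ?thesis
      using that by auto
  qed
  have fu: "f u = ?a + c - u" and fv: "f v = ?a + c - v"
    using f_band vals c' by auto
  show "f ?a = ?a"
    unfolding f_def using aL by (rule band_flip_fixed)
  show "?a < f v" "f v < f u"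
    using fu fv vals c' by auto
  have fu_c: "f u < c"
    using fu vals c' by auto
  have flip_at: "at1 (flip_bands \<pi>) m = f (at1 \<pi> m)" if "1 \<le> m" "m \<le> n" for m
    unfolding f_def using that len by (simp add: nth_flip_bands)
  show "empty_boxes R (flip_bands \<pi>) [0, i, j, k, n + 1] [0, ?a, f v, f u, n + 1]"
    unfolding empty_boxes_def
  proof (clarify)
    fix x y m
    assume xy: "(x, y) \<in> R"
      and m: "[0, i, j, k, n + 1] ! x < m" "m < [0, i, j, k, n + 1] ! (x + 1)"
      and y: "[0, ?a, f v, f u, n + 1] ! y < at1 (flip_bands \<pi>) m"
        "at1 (flip_bands \<pi>) m < [0, ?a, f v, f u, n + 1] ! (y + 1)"
    have x_cases: "x = 0 \<or> x = 1 \<or> x = 2 \<or> x = 3" and y_cases: "y = 0 \<or> y = 1 \<or> y = 2 \<or> y = 3"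
      using xy R(1) by auto
    have mn: "1 \<le> m" "m \<le> n"
      using m x_cases pos by (auto simp: numeral_2_eq_2 numeral_3_eq_3)
    define w where "w = at1 \<pi> m"
    have w: "w \<in> {1..n}"
      unfolding w_def using range mn by blast
    have y': "[0, ?a, f v, f u, n + 1] ! y < f w" "f w < [0, ?a, f v, f u, n + 1] ! (y + 1)"
      using y flip_at[OF mn] by (auto simp: w_def)
    \<comment> \<open>Positions are unchanged, so the entry at \<open>m\<close> has the same column
      \<open>x\<close> before and after; only its row can differ.\<close>
    have nbox: "\<not> ([0, ?a, u, v, n + 1] ! y' < w \<and> w < [0, ?a, u, v, n + 1] ! (y' + 1))"
      if "(x, y') \<in> R" for y'
      using box[OF that] m by (auto simp: w_def)
    show False
    proof (cases "x = 0")
      case True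
      then have m_lt: "m < i"
        using m by simp
      have "v < w"
        unfolding w_def using before mn m_lt by blast
      \<comment> \<open>Otherwise \<open>w\<close> is inside the band, hence not a minimum, and some
        minimum below \<open>w\<close> stands further left. By \<open>before\<close> that minimum
        exceeds \<open>v\<close>, so it would lie strictly inside the band.\<close>
      have "c \<le> w"
      proof (rule ccontr)
        assume "\<not> c \<le> w"
        have "\<not> is_lr_min \<pi> (m - 1)"
          using sep[of w] \<open>\<not> c \<le> w\<close> \<open>v < w\<close> vals by (auto simp: lr_minima_def w_def)
        moreover have "m - 1 < length \<pi>"
          using mn len by linarith
        ultimately obtain p where p: "p < m - 1" "is_lr_min \<pi> p" "\<pi> ! p < w"
          using exists_lr_min_before[OF perms_distinct[OF \<pi>]] unfolding w_def by blast
        have "v < \<pi> ! p"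
          using before[of "p + 1"] p m_lt by auto
        then show False
          using sep[of "\<pi> ! p"] p \<open>\<not> c \<le> w\<close> vals by (auto simp: lr_minima_def)
      qed
      then have "f u < f w"
        using f_above[OF w] fu_c by auto
      then have "y = 3"
        using y' y_cases \<open>?a < f v\<close> \<open>f v < f u\<close> by (auto simp: numeral_2_eq_2)
      then show False
        using nbox[of 3] xy \<open>v < w\<close> w by auto
    next
      case False
      then have x13: "x \<in> {1..3}"
        using x_cases by auto
      \<comment> \<open>Row 3 is split at \<open>c\<close>: its part inside the band comes from row
        1, the rest from row 3.\<close>
      consider "y = 0" | "y = 1" | "y = 2" | "y = 3" "f w < c" | "y = 3" "c \<le> f w"
        using y_cases by linarith
      then show False
      proof cases
        case 1
        then show ?thesis
          using y' f_below[OF w] nbox[of 0] xy w by auto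
      next
        case 2
        then have fw: "?a < f w" "f w < f v"
          using y' by auto
        then have "?a < w" "w < c"
          using f_below[OF w] f_above[OF w] fv vals c' by auto
        \<comment> \<open>Reflection reverses order, so an entry below \<open>f v\<close> in the
          band was above \<open>v\<close>: new row 1 comes from old row 3.\<close>
        then have "v < w"
          using fw fv f_band[of w] by linarith
        then show ?thesis
          using nbox[of 3] R(5)[OF x13] xy 2 w by auto
      next
        case 3
        then have fw: "f v < f w" "f w < f u"
          using y' by (auto simp: numeral_2_eq_2)
        then have "?a < w" "w < c"
          using f_below[OF w] f_above[OF w] fu_c \<open>?a < f v\<close> by auto
        then have "u < w" "w < v"
          using fw fu fv f_band[of w] by linarith+
        then show ?thesis
          using nbox[of 2] xy 3 by (auto simp: numeral_2_eq_2)
      next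
        case 4
        then have fw: "f u < f w"
          using y' by auto
        then have "?a < w" "w < c"
          using f_below[OF w] f_above[OF w] 4 \<open>?a < f v\<close> \<open>f v < f u\<close> by auto
        then have "w < u"
          using fw fu f_band[of w] by linarith
        then show ?thesis
          using nbox[of 1] R(5)[OF x13] xy 4 \<open>?a < w\<close> by auto
      next
        case 5
        then have "v < w"
          using f_above[OF w] c' by auto
        then show ?thesis
          using nbox[of 3] xy 5 w by auto
      qed
    qed
  qed
qed

text \<open>Each pattern's occurrences become occurrences of the other at the same positions, for
  every permutation. Since the flip is an involution, these inclusions give equalities.\<close>

lemma occurrences_flip_bands:
  assumes \<pi>: "\<pi> \<in> perms n"
    and R: "R \<subseteq> {0..3} \<times> {0..3}" "(0,0) \<in> R" "(0,1) \<in> R" "(0,2) \<in> R"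
      "\<And>x. x \<in> {1..3} \<Longrightarrow> (x,1) \<in> R \<longleftrightarrow> (x,3) \<in> R"
  shows "occurrences ([1,2,3], R) (flip_bands \<pi>) = occurrences ([1,3,2], R) \<pi>"
    and "occurrences ([1,3,2], R) (flip_bands \<pi>) = occurrences ([1,2,3], R) \<pi>"
proof -
  have sub_132: "occurrences ([1,2,3], R) \<sigma> \<subseteq> occurrences ([1,3,2], R) (flip_bands \<sigma>)"
    if \<sigma>: "\<sigma> \<in> perms n" for \<sigma>
  proof
    fix "is" assume "is \<in> occurrences ([1,2,3], R) \<sigma>"
    then obtain i j k where ijk: "is = [i, j, k]" "1 \<le> i" "i < j" "j < k" "k \<le> n"
      "at1 \<sigma> i < at1 \<sigma> j" "at1 \<sigma> j < at1 \<sigma> k"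
      "empty_boxes R \<sigma> [0, i, j, k, n + 1] [0, at1 \<sigma> i, at1 \<sigma> j, at1 \<sigma> k, n + 1]"
      using occurrences_123_iff[of \<sigma> n] \<sigma> by (auto simp: perms_iff)
    note flipped = empty_boxes_flip_bands[OF \<sigma> R ijk(2-7) refl ijk(8)]
    have "at1 (flip_bands \<sigma>) m = band_flip n (lr_minima \<sigma>) (at1 \<sigma> m)" if "m \<in> {i, j, k}" for m
      using nth_flip_bands[of "m - 1" \<sigma>] that ijk \<sigma> by (auto simp: perms_iff)
    then show "is \<in> occurrences ([1,3,2], R) (flip_bands \<sigma>)"
      using flipped ijk flip_bands_perm[OF \<sigma>] by (subst occurrences_132_iff[of _ n]) (auto simp: perms_iff)
  qed
  have sub_123: "occurrences ([1,3,2], R) \<sigma> \<subseteq> occurrences ([1,2,3], R) (flip_bands \<sigma>)"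
    if \<sigma>: "\<sigma> \<in> perms n" for \<sigma>
  proof
    fix "is" assume "is \<in> occurrences ([1,3,2], R) \<sigma>"
    then obtain i j k where ijk: "is = [i, j, k]" "1 \<le> i" "i < j" "j < k" "k \<le> n"
      "at1 \<sigma> i < at1 \<sigma> k" "at1 \<sigma> k < at1 \<sigma> j"
      "empty_boxes R \<sigma> [0, i, j, k, n + 1] [0, at1 \<sigma> i, at1 \<sigma> k, at1 \<sigma> j, n + 1]"
      using occurrences_132_iff[of \<sigma> n] \<sigma> by (auto simp: perms_iff)
    \<comment> \<open>Now the middle value is at \<open>k\<close> and the top one at
      \<open>j\<close>, so the set equation holds by commuting the two elements.\<close>
    note flipped = empty_boxes_flip_bands[OF \<sigma> R ijk(2-7) insert_commute ijk(8)]
    have "at1 (flip_bands \<sigma>) m = band_flip n (lr_minima \<sigma>) (at1 \<sigma> m)" if "m \<in> {i, j, k}" for m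
      using nth_flip_bands[of "m - 1" \<sigma>] that ijk \<sigma> by (auto simp: perms_iff)
    then show "is \<in> occurrences ([1,2,3], R) (flip_bands \<sigma>)"
      using flipped ijk flip_bands_perm[OF \<sigma>] by (subst occurrences_123_iff[of _ n]) (auto simp: perms_iff)
  qed
  show "occurrences ([1,2,3], R) (flip_bands \<pi>) = occurrences ([1,3,2], R) \<pi>"
    \<comment> \<open>One inclusion is taken at the flipped permutation, whose flip is
      \<open>\<pi>\<close>, the other at \<open>\<pi>\<close> itself.\<close>
    using sub_132[OF flip_bands_perm[OF \<pi>]] sub_123[OF \<pi>] flip_bands_flip_bands[OF \<pi>] by simp
  show "occurrences ([1,3,2], R) (flip_bands \<pi>) = occurrences ([1,2,3], R) \<pi>"
    using sub_123[OF flip_bands_perm[OF \<pi>]] sub_132[OF \<pi>] flip_bands_flip_bands[OF \<pi>] by simp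
qed

section \<open>Joint equidistribution from the involution\<close>

lemma is_mesh_pattern_123: "R \<subseteq> {0..3} \<times> {0..3} \<Longrightarrow> is_mesh_pattern ([1,2,3], R)"
  by (auto simp: is_mesh_pattern_def perms_iff)

lemma is_mesh_pattern_132: "R \<subseteq> {0..3} \<times> {0..3} \<Longrightarrow> is_mesh_pattern ([1,3,2], R)"
  by (auto simp: is_mesh_pattern_def perms_iff)

text \<open>The flip exchanges the two occurrence sets and hence the two counts; as an involution it
  is a bijection between the two classes of permutations.\<close>

lemma jointly_equidistributed_if_rows_agree:
  assumes R: "R \<subseteq> {0..3} \<times> {0..3}" "(0,0) \<in> R" "(0,1) \<in> R" "(0,2) \<in> R"
      "\<And>x. x \<in> {1..3} \<Longrightarrow> (x,1) \<in> R \<longleftrightarrow> (x,3) \<in> R"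
  shows "([1,2,3], R) \<sim>jd ([1,3,2], R)"
proof -
  have "card {\<pi> \<in> perms n. card (occurrences ([1,2,3], R) \<pi>) = k \<and> card (occurrences ([1,3,2], R) \<pi>) = l} =
        card {\<pi> \<in> perms n. card (occurrences ([1,2,3], R) \<pi>) = l \<and> card (occurrences ([1,3,2], R) \<pi>) = k}"
    for n k l
    by (intro bij_betw_same_card[of flip_bands] bij_betw_byWitness[where f' = flip_bands])
      (auto simp: occurrences_flip_bands[OF _ R, simplified] flip_bands_flip_bands flip_bands_perm)
  then show ?thesis
    using is_mesh_pattern_123[OF R(1)] is_mesh_pattern_132[OF R(1)]
    by (simp add: jointly_equidistributed_def)
qed

section \<open>Inverse permutations\<close>

definition inverse_perm :: "nat list \<Rightarrow> nat list" where
  "inverse_perm \<pi> = map (inv_into {1..length \<pi>} (at1 \<pi>)) [1..<length \<pi> + 1]"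

lemma bij_betw_at1:
  assumes "\<pi> \<in> perms n"
  shows "bij_betw (at1 \<pi>) {1..n} {1..n}"
proof -
  have inj: "inj_on (at1 \<pi>) {1..n}"
    using at1_perm_inj[OF assms] by (auto intro!: inj_onI)
  have "at1 \<pi> ` {1..n} \<subseteq> {1..n}"
    using at1_perm_in[OF assms] by auto
  then show ?thesis
    using inj by (simp add: bij_betw_def endo_inj_surj)
qed

lemma at1_inverse_perm:
  assumes "\<pi> \<in> perms n" "1 \<le> v" "v \<le> n"
  shows "at1 (inverse_perm \<pi>) v = inv_into {1..n} (at1 \<pi>) v"
  using assms by (simp add: inverse_perm_def perms_iff del: upt_Suc)

lemma inverse_perm_perm:
  assumes "\<pi> \<in> perms n"
  shows "inverse_perm \<pi> \<in> perms n"
proof -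
  have "set (inverse_perm \<pi>) = inv_into {1..n} (at1 \<pi>) ` {1..n}"
    using assms by (auto simp: inverse_perm_def perms_iff atLeastLessThanSuc_atLeastAtMost simp del: upt_Suc)
  also have "\<dots> = {1..n}"
    using bij_betw_inv_into[OF bij_betw_at1[OF assms]] by (simp add: bij_betw_def)
  finally show ?thesis
    using assms by (simp add: perms_iff inverse_perm_def del: upt_Suc)
qed

lemma at1_inverse_at1:
  assumes "\<pi> \<in> perms n" "1 \<le> m" "m \<le> n"
  shows "at1 (inverse_perm \<pi>) (at1 \<pi> m) = m"
proof -
  have "at1 \<pi> m \<in> {1..n}"
    using assms by (rule at1_perm_in)
  then have "at1 (inverse_perm \<pi>) (at1 \<pi> m) = inv_into {1..n} (at1 \<pi>) (at1 \<pi> m)"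
    by (intro at1_inverse_perm[OF assms(1)]) auto
  also have "\<dots> = m"
    by (rule bij_betw_inv_into_left[OF bij_betw_at1[OF assms(1)]]) (use assms in auto)
  finally show ?thesis .
qed

lemma at1_at1_inverse:
  assumes "\<pi> \<in> perms n" "1 \<le> v" "v \<le> n"
  shows "at1 \<pi> (at1 (inverse_perm \<pi>) v) = v"
  unfolding at1_inverse_perm[OF assms]
  by (rule bij_betw_inv_into_right[OF bij_betw_at1[OF assms(1)]]) (use assms in auto)

lemma inverse_perm_inverse_perm:
  assumes "\<pi> \<in> perms n"
  shows "inverse_perm (inverse_perm \<pi>) = \<pi>"
proof (rule nth_equalityI)
  note inv = inverse_perm_perm[OF assms]
  show "length (inverse_perm (inverse_perm \<pi>)) = length \<pi>"
    by (simp add: inverse_perm_def del: upt_Suc)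
  fix p assume "p < length (inverse_perm (inverse_perm \<pi>))"
  then have p: "1 \<le> p + 1" "p + 1 \<le> n"
    using assms by (auto simp: inverse_perm_def perms_iff simp del: upt_Suc)
  have v: "1 \<le> at1 (inverse_perm (inverse_perm \<pi>)) (p + 1)" "at1 (inverse_perm (inverse_perm \<pi>)) (p + 1) \<le> n"
    using at1_perm_in[OF inverse_perm_perm[OF inv] p] by auto
  have "at1 (inverse_perm \<pi>) (at1 (inverse_perm (inverse_perm \<pi>)) (p + 1)) = p + 1"
    using at1_at1_inverse[OF inv p] .
  then have "at1 (inverse_perm (inverse_perm \<pi>)) (p + 1) = at1 \<pi> (p + 1)"
    using at1_at1_inverse[OF assms v] by simp
  then show "inverse_perm (inverse_perm \<pi>) ! p = \<pi> ! p"
    by simp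
qed

text \<open>Inversion reflects the diagram in the diagonal: the point with coordinates m and
  \<pi>(m) trades them, box (a,b) becomes (b,a), and the position and value lists change
  roles.\<close>

lemma empty_boxes_inverse:
  assumes "\<pi> \<in> perms n" "\<And>a b. (a, b) \<in> R \<Longrightarrow> vs ! (b + 1) \<le> n + 1"
    and "empty_boxes R \<pi> is vs"
  shows "empty_boxes (prod.swap ` R) (inverse_perm \<pi>) vs is"
proof -
  have "\<not> (vs ! b < m \<and> m < vs ! (b + 1) \<and>
      is ! a < at1 (inverse_perm \<pi>) m \<and> at1 (inverse_perm \<pi>) m < is ! (a + 1))"
    if "(b, a) \<in> prod.swap ` R" for a b m
  proof
    have ab: "(a, b) \<in> R"
      using that by auto
    assume m: "vs ! b < m \<and> m < vs ! (b + 1) \<and>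
      is ! a < at1 (inverse_perm \<pi>) m \<and> at1 (inverse_perm \<pi>) m < is ! (a + 1)"
    \<comment> \<open>The bound on \<open>vs\<close> keeps \<open>m\<close> among the genuine
      values; outside 1 to n the entries of the inverse are junk.\<close>
    then have "1 \<le> m" "m \<le> n"
      using assms(2)[OF ab] by auto
    then have "at1 \<pi> (at1 (inverse_perm \<pi>) m) = m"
      by (rule at1_at1_inverse[OF assms(1)])
    then show False
      using assms(3) ab m unfolding empty_boxes_def by (metis (mono_tags, lifting) case_prodD)
  qed
  then show ?thesis
    unfolding empty_boxes_def by blast
qed

text \<open>Both 123 and 132 are their own inverses, so the letters of an occurrence, sent to
  positions of the inverse, form an occurrence of the same pattern. An injection suffices, as the
  reverse inequality follows by inverting once more.\<close>

lemma card_occurrences_inverse_le: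
  assumes \<pi>: "\<pi> \<in> perms n" and R: "R \<subseteq> {0..3} \<times> {0..3}"
  shows "card (occurrences ([1,2,3], R) \<pi>) \<le> card (occurrences ([1,2,3], prod.swap ` R) (inverse_perm \<pi>))"
    and "card (occurrences ([1,3,2], R) \<pi>) \<le> card (occurrences ([1,3,2], prod.swap ` R) (inverse_perm \<pi>))"
proof -
  have len: "length \<pi> = n" "length (inverse_perm \<pi>) = n"
    using \<pi> inverse_perm_perm[OF \<pi>] by (auto simp: perms_iff)
  have bound: "[0, x, y, z, n + 1] ! (b + 1) \<le> n + 1"
    if "(a, b) \<in> R" "x \<le> n" "y \<le> n" "z \<le> n" for a b x y z
  proof -
    have "b = 0 \<or> b = 1 \<or> b = 2 \<or> b = 3"
      using that(1) R by auto
    then show ?thesis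
      using that by (auto simp: numeral_2_eq_2 numeral_3_eq_3)
  qed
  have range: "1 \<le> at1 \<pi> m" "at1 \<pi> m \<le> n" if "1 \<le> m" "m \<le> n" for m
    using at1_perm_in[OF \<pi> that] by auto
  have inj: "inj_on (map (at1 \<pi>)) {is. set is \<subseteq> {1..n}}"
  proof (rule inj_onI)
    fix xs ys
    assume "xs \<in> {is. set is \<subseteq> {1..n}}" "ys \<in> {is. set is \<subseteq> {1..n}}"
      and eq: "map (at1 \<pi>) xs = map (at1 \<pi>) ys"
    then have "inj_on (at1 \<pi>) (set xs \<union> set ys)"
      using bij_betw_at1[OF \<pi>] by (auto simp: bij_betw_def intro: inj_on_subset)
    then show "xs = ys"
      using eq by (rule map_inj_on[rotated])
  qed
  show "card (occurrences ([1,2,3], R) \<pi>) \<le> card (occurrences ([1,2,3], prod.swap ` R) (inverse_perm \<pi>))"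
  proof (rule card_inj_on_le[OF _ _ finite_occurrences])
    show "inj_on (map (at1 \<pi>)) (occurrences ([1,2,3], R) \<pi>)"
      using inj by (rule inj_on_subset) (auto simp: occurrences_def len)
    show "map (at1 \<pi>) ` occurrences ([1,2,3], R) \<pi> \<subseteq> occurrences ([1,2,3], prod.swap ` R) (inverse_perm \<pi>)"
    proof (rule image_subsetI)
      fix "is" assume "is \<in> occurrences ([1,2,3], R) \<pi>"
      then obtain i j k where ijk: "is = [i, j, k]" "1 \<le> i" "i < j" "j < k" "k \<le> n"
        "at1 \<pi> i < at1 \<pi> j" "at1 \<pi> j < at1 \<pi> k"
        "empty_boxes R \<pi> [0, i, j, k, n + 1] [0, at1 \<pi> i, at1 \<pi> j, at1 \<pi> k, n + 1]"
        using occurrences_123_iff[OF len(1)] by blast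
      have "empty_boxes (prod.swap ` R) (inverse_perm \<pi>)
          [0, at1 \<pi> i, at1 \<pi> j, at1 \<pi> k, n + 1] [0, i, j, k, n + 1]"
        using ijk by (intro empty_boxes_inverse[OF \<pi>] bound range) auto
      moreover have "at1 (inverse_perm \<pi>) (at1 \<pi> m) = m" if "m \<in> {i, j, k}" for m
        using at1_inverse_at1[OF \<pi>, of m] that ijk by auto
      ultimately show "map (at1 \<pi>) is \<in> occurrences ([1,2,3], prod.swap ` R) (inverse_perm \<pi>)"
        using ijk range[of i] range[of k] by (subst occurrences_123_iff[OF len(2)]) auto
    qed
  qed
  show "card (occurrences ([1,3,2], R) \<pi>) \<le> card (occurrences ([1,3,2], prod.swap ` R) (inverse_perm \<pi>))"
  proof (rule card_inj_on_le[OF _ _ finite_occurrences])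
    \<comment> \<open>The values of a 132 occurrence increase in the order first, third, second, and
      a position list must be increasing.\<close>
    let ?g = "\<lambda>is. map (at1 \<pi>) [is ! 0, is ! 2, is ! 1]"
    show "inj_on ?g (occurrences ([1,3,2], R) \<pi>)"
    proof (rule inj_onI)
      fix is1 is2
      assume is1: "is1 \<in> occurrences ([1,3,2], R) \<pi>" and is2: "is2 \<in> occurrences ([1,3,2], R) \<pi>"
        and eq: "?g is1 = ?g is2"
      obtain i j k i' j' k' where ijk: "is1 = [i, j, k]" "is2 = [i', j', k']"
        using is1 is2 unfolding occurrences_132_iff[OF len(1)] by blast
      have "map (at1 \<pi>) is1 = map (at1 \<pi>) is2"
        using eq by (simp add: ijk)
      moreover have "set is1 \<subseteq> {1..n}" "set is2 \<subseteq> {1..n}"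
        using is1 is2 by (auto simp: occurrences_def len)
      ultimately show "is1 = is2"
        using inj by (auto dest: inj_onD)
    qed
    show "?g ` occurrences ([1,3,2], R) \<pi> \<subseteq> occurrences ([1,3,2], prod.swap ` R) (inverse_perm \<pi>)"
    proof (rule image_subsetI)
      fix "is" assume "is \<in> occurrences ([1,3,2], R) \<pi>"
      then obtain i j k where ijk: "is = [i, j, k]" "1 \<le> i" "i < j" "j < k" "k \<le> n"
        "at1 \<pi> i < at1 \<pi> k" "at1 \<pi> k < at1 \<pi> j"
        "empty_boxes R \<pi> [0, i, j, k, n + 1] [0, at1 \<pi> i, at1 \<pi> k, at1 \<pi> j, n + 1]"
        using occurrences_132_iff[OF len(1)] by blast
      have "empty_boxes (prod.swap ` R) (inverse_perm \<pi>)
          [0, at1 \<pi> i, at1 \<pi> k, at1 \<pi> j, n + 1] [0, i, j, k, n + 1]"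
        using ijk by (intro empty_boxes_inverse[OF \<pi>] bound range) auto
      moreover have "at1 (inverse_perm \<pi>) (at1 \<pi> m) = m" if "m \<in> {i, j, k}" for m
        using at1_inverse_at1[OF \<pi>, of m] that ijk by auto
      ultimately show "?g is \<in> occurrences ([1,3,2], prod.swap ` R) (inverse_perm \<pi>)"
        using ijk range[of i] range[of j] by (subst occurrences_132_iff[OF len(2)]) auto
    qed
  qed
qed

text \<open>The inequality is applied to \<open>\<pi>\<close> with \<open>R\<close> and to its
  inverse with the transposed shading; doing both operations twice returns to the start.\<close>

lemma card_occurrences_inverse:
  assumes \<pi>: "\<pi> \<in> perms n" and R: "R \<subseteq> {0..3} \<times> {0..3}"
  shows "card (occurrences ([1,2,3], prod.swap ` R) (inverse_perm \<pi>)) = card (occurrences ([1,2,3], R) \<pi>)"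
    and "card (occurrences ([1,3,2], prod.swap ` R) (inverse_perm \<pi>)) = card (occurrences ([1,3,2], R) \<pi>)"
proof -
  have R': "prod.swap ` R \<subseteq> {0..3} \<times> {0..3}" and swap: "prod.swap ` prod.swap ` R = R"
    using R by (auto simp: image_image)
  note le = card_occurrences_inverse_le[OF \<pi> R]
    card_occurrences_inverse_le[OF inverse_perm_perm[OF \<pi>] R', unfolded swap inverse_perm_inverse_perm[OF \<pi>]]
  show "card (occurrences ([1,2,3], prod.swap ` R) (inverse_perm \<pi>)) = card (occurrences ([1,2,3], R) \<pi>)"
    using le(1,3) by (rule antisym[rotated])
  show "card (occurrences ([1,3,2], prod.swap ` R) (inverse_perm \<pi>)) = card (occurrences ([1,3,2], R) \<pi>)"
    using le(2,4) by (rule antisym[rotated])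
qed

text \<open>Inversion preserves both counts at once when the shading is transposed, so the joint
  distributions for \<open>R\<close> and its transpose coincide, and the symmetry carries
  over.\<close>

lemma jointly_equidistributed_transpose:
  assumes R: "R \<subseteq> {0..3} \<times> {0..3}" and jd: "([1,2,3], R) \<sim>jd ([1,3,2], R)"
  shows "([1,2,3], prod.swap ` R) \<sim>jd ([1,3,2], prod.swap ` R)"
proof -
  have transfer: "card {\<pi> \<in> perms n. card (occurrences ([1,2,3], prod.swap ` R) \<pi>) = k \<and>
        card (occurrences ([1,3,2], prod.swap ` R) \<pi>) = l} =
      card {\<pi> \<in> perms n. card (occurrences ([1,2,3], R) \<pi>) = k \<and> card (occurrences ([1,3,2], R) \<pi>) = l}"
    for n k l
  proof (intro bij_betw_same_card[of inverse_perm] bij_betw_byWitness[where f' = inverse_perm])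
    show "inverse_perm ` {\<pi> \<in> perms n. card (occurrences ([1,2,3], prod.swap ` R) \<pi>) = k \<and>
        card (occurrences ([1,3,2], prod.swap ` R) \<pi>) = l}
      \<subseteq> {\<pi> \<in> perms n. card (occurrences ([1,2,3], R) \<pi>) = k \<and> card (occurrences ([1,3,2], R) \<pi>) = l}"
      using card_occurrences_inverse[OF inverse_perm_perm R] inverse_perm_inverse_perm inverse_perm_perm
      by fastforce
  qed (auto simp: inverse_perm_inverse_perm inverse_perm_perm card_occurrences_inverse[OF _ R, simplified])
  have "prod.swap ` R \<subseteq> {0..3} \<times> {0..3}"
    using R by auto
  then show ?thesis
    using jd is_mesh_pattern_123 is_mesh_pattern_132 unfolding jointly_equidistributed_def transfer by blast
qed

section \<open>The eight shadings and their transposes\<close>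

theorem mainTheorem5:
  shows "\<forall>j \<in> {1..8}. ([1,2,3], X j) \<sim>jd ([1,3,2], X j) \<and> ([1,2,3], Y j) \<sim>jd ([1,3,2], Y j)"
proof
  fix j :: nat
  assume "j \<in> {1..8}"
  then have j: "j \<in> {1, 2, 3, 4, 5, 6, 7, 8}"
    by auto
  have sub: "X j \<subseteq> {0..3} \<times> {0..3}"
    using j by (auto simp: X_def B_def S_def)
  \<comment> \<open>A check over the eight sets: each \<open>S j\<close> contains (x,1) exactly when
    it contains (x,3), and \<open>B\<close> has nothing in rows 1 and 3 to the right of column
    0.\<close>
  have rows: "(x, 1) \<in> X j \<longleftrightarrow> (x, 3) \<in> X j" if "x \<in> {1..3}" for x
    using j that by (auto simp: X_def B_def S_def)
  have jd: "([1,2,3], X j) \<sim>jd ([1,3,2], X j)"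
    by (rule jointly_equidistributed_if_rows_agree[OF sub _ _ _ rows]) (simp_all add: X_def B_def)
  have "Y j = prod.swap ` X j"
    by (force simp: Y_def)
  then show "([1,2,3], X j) \<sim>jd ([1,3,2], X j) \<and> ([1,2,3], Y j) \<sim>jd ([1,3,2], Y j)"
    using jd jointly_equidistributed_transpose[OF sub jd] by simp
qed

end
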